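(* Let $\mathcal{M}_i=(E_i,\rho_i)$, $i=1,2$, be $q$-matroids and $E=E_1\oplus E_2$. Choose non-degenerate symmetric bilinear forms $\langle\cdot,\cdot\rangle_i$ on $E_i$ and define $\langle v_1+v_2,w_1+w_2\rangle=\langle v_1,w_1\rangle_1+\langle v_2,w_2\rangle_2$ for $v_i,w_i\in E_i$. Then $\langle\cdot,\cdot\rangle$ is a non-degenerate symmetric bilinear form on $E$ and \[ (\mathcal{M}_1\oplus\mathcal{M}_2)^*=\mathcal{M}_1^*\oplus\mathcal{M}_2^*, \] where $\mathcal{M}_i^*$ is the dual with respect to $\langle\cdot,\cdot\rangle_i$ and $(\mathcal{M}_1\oplus\mathcal{M}_2)^*$ the dual with respect to $\langle\cdot,\cdot\rangle$.
   Context: Let $\mathbb{F}=\mathbb{F}_q$. A $q$-matroid is $\mathcal{M}=(E,\rho)$, $E$ a finite-dimensional $\mathbb{F}$-vector space, $\rho$ from subspaces to $\mathbb{Z}_{\ge0}$ with $0\le\rho(V)\le\dim V$, monotone and submodular. Given a non-degenerate symmetric bilinear form on $E$ with orthogonal spaces $V^\perp$, the dual of $\mathcal{M}$ is $\mathcal{M}^*=(E,\rho^* )$ with $\rho^*(V)=\dim V+\rho(V^\perp)-\rho(E)$. Direct sum: for $E=E_1\oplus E_2$ with projections $\pi_i:E\to E_i$, $\mathcal{M}_1\oplus\mathcal{M}_2=(E,\rho)$ where $\rho(V)=\dim V+\min_{X\le V}(\rho_1(\pi_1(X))+\rho_2(\pi_2(X))-\dim X)$. *)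

theory Defs
  imports "HOL-Analysis.Analysis"
begin

text \<open>Finite-dimensional spaces over a finite field F = 'a are represented as
coordinate spaces 'a ^ 'n.  Rank functions are integer valued (with the
nonnegativity required explicitly), so that the subtraction in the dual is exact.\<close>

definition qsubspace :: "('a::field ^ 'n) set \<Rightarrow> bool" where
  "qsubspace V \<longleftrightarrow> vec.subspace V"

definition qdim :: "('a::field ^ 'n) set \<Rightarrow> int" where
  "qdim V = int (vec.dim V)"

definition qmatroid :: "(('a::{field,finite} ^ 'n) set \<Rightarrow> int) \<Rightarrow> bool" where
  "qmatroid \<rho> \<longleftrightarrow>
     (\<forall>V. qsubspace V \<longrightarrow> 0 \<le> \<rho> V \<and> \<rho> V \<le> qdim V) \<and>
     (\<forall>V W. qsubspace V \<and> qsubspace W \<and> V \<subseteq> W \<longrightarrow> \<rho> V \<le> \<rho> W) \<and>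
     (\<forall>V W. qsubspace V \<and> qsubspace W \<longrightarrow>
        \<rho> (vec.span (V \<union> W)) + \<rho> (V \<inter> W) \<le> \<rho> V + \<rho> W)"

definition sym_bilinear_nondeg :: "('a::field ^ 'n \<Rightarrow> 'a ^ 'n \<Rightarrow> 'a) \<Rightarrow> bool" where
  "sym_bilinear_nondeg B \<longleftrightarrow>
     (\<forall>x. Vector_Spaces.linear (*s) (*) (B x)) \<and>
     (\<forall>x y. B x y = B y x) \<and>
     (\<forall>x. (\<forall>y. B x y = 0) \<longrightarrow> x = 0)"

definition orth :: "('a::field ^ 'n \<Rightarrow> 'a ^ 'n \<Rightarrow> 'a) \<Rightarrow> ('a ^ 'n) set \<Rightarrow> ('a ^ 'n) set" where
  "orth B V = {w. \<forall>v\<in>V. B v w = 0}"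

definition qdual :: "('a::field ^ 'n \<Rightarrow> 'a ^ 'n \<Rightarrow> 'a) \<Rightarrow> (('a ^ 'n) set \<Rightarrow> int)
    \<Rightarrow> ('a ^ 'n) set \<Rightarrow> int" where
  "qdual B \<rho> V = qdim V + \<rho> (orth B V) - \<rho> UNIV"

text \<open>E = E1 \<oplus> E2 realised as 'a ^ ('n + 'm).\<close>

definition proj1 :: "'a ^ ('n::finite + 'm::finite) \<Rightarrow> 'a ^ 'n" where
  "proj1 v = (\<chi> j. v $ Inl j)"

definition proj2 :: "'a ^ ('n::finite + 'm::finite) \<Rightarrow> 'a ^ 'm" where
  "proj2 v = (\<chi> j. v $ Inr j)"

definition qdirect_sum :: "(('a::{field,finite} ^ 'n) set \<Rightarrow> int) \<Rightarrow> (('a ^ 'm) set \<Rightarrow> int)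
    \<Rightarrow> ('a ^ ('n + 'm)) set \<Rightarrow> int" where
  "qdirect_sum \<rho>1 \<rho>2 V = qdim V +
     Min {\<rho>1 (proj1 ` X) + \<rho>2 (proj2 ` X) - qdim X | X. qsubspace X \<and> X \<subseteq> V}"

definition sum_form :: "('a::field ^ 'n \<Rightarrow> 'a ^ 'n \<Rightarrow> 'a) \<Rightarrow> ('a ^ 'm \<Rightarrow> 'a ^ 'm \<Rightarrow> 'a)
    \<Rightarrow> 'a ^ ('n + 'm) \<Rightarrow> 'a ^ ('n + 'm) \<Rightarrow> 'a" where
  "sum_form B1 B2 v w = B1 (proj1 v) (proj1 w) + B2 (proj2 v) (proj2 w)"

end

theory Submission
  imports Defs
begin

text \<open>Write the direct-sum rank as \<rho>(V) = dim V + min over X \<le> V of the excess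
  \<rho>1(\<pi>1 X) + \<rho>2(\<pi>2 X) - dim X. After unfolding the dual, the theorem says that the minimal
  excess of \<rho>1, \<rho>2 over subspaces Y \<le> orth V, shifted by dim (orth V), equals the minimal
  excess of the duals over subspaces X \<le> V, shifted by \<rho>1(E1) + \<rho>2(E2) (which is also \<rho>(E)).
  The two minima are compared by explicit transport: X goes to Y = orth (V + \<pi>1 X \<oplus> \<pi>2 X),
  and Y goes to X = V \<inter> orth (\<pi>1 Y \<oplus> \<pi>2 Y). Neither move increases the shifted excess, by
  dim U + dim (orth U) = dim E, the modular law, monotonicity of \<rho>i, and
  \<rho>i(U) - \<rho>i(T) \<le> dim U - dim T for T \<le> U.\<close>

section \<open>Orthogonal complements and dimension\<close>

lemma sym_bilinear_nondeg_bilinear: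
  assumes "sym_bilinear_nondeg B"
  shows "B x (y + z) = B x y + B x z" "B x (c *s y) = c * B x y" "B x 0 = 0"
    and "B (y + z) x = B y x + B z x" "B (c *s y) x = c * B y x" "B 0 x = 0"
proof -
  have sym: "B u v = B v u" for u v
    using assms by (simp add: sym_bilinear_nondeg_def)
  interpret Vector_Spaces.linear "(*s)" "(*)" "B x"
    using assms by (simp add: sym_bilinear_nondeg_def)
  show right: "B x (y + z) = B x y + B x z" "B x (c *s y) = c * B x y" "B x 0 = 0"
    by (simp_all add: add scale)
  show "B (y + z) x = B y x + B z x" "B (c *s y) x = c * B y x" "B 0 x = 0"
    using right by (simp_all add: sym)
qed

lemma orth_subspace:
  assumes "sym_bilinear_nondeg B"
  shows "vec.subspace (orth B U)"
  using sym_bilinear_nondeg_bilinear[OF assms] by (auto simp: vec.subspace_def orth_def)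

lemma orth_antimono: "U \<subseteq> W \<Longrightarrow> orth B W \<subseteq> orth B U"
  unfolding orth_def by auto

lemma orth_Un: "orth B (U \<union> W) = orth B U \<inter> orth B W"
  unfolding orth_def by auto

lemma subset_orth_commute:
  assumes "sym_bilinear_nondeg B"
  shows "U \<subseteq> orth B W \<longleftrightarrow> W \<subseteq> orth B U"
proof -
  have sym: "B u w = B w u" for u w
    using assms by (simp add: sym_bilinear_nondeg_def)
  show ?thesis
    unfolding orth_def subset_eq mem_Collect_eq by (metis sym)
qed

lemma orth_span:
  assumes B: "sym_bilinear_nondeg B"
  shows "orth B (vec.span U) = orth B U"
proof
  show "orth B (vec.span U) \<subseteq> orth B U"
    by (rule orth_antimono) (rule vec.span_superset)
  show "orth B U \<subseteq> orth B (vec.span U)"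
  proof
    fix w assume w: "w \<in> orth B U"
    have "vec.subspace {v. B v w = 0}"
      using sym_bilinear_nondeg_bilinear[OF B] by (auto simp: vec.subspace_def)
    moreover have "U \<subseteq> {v. B v w = 0}"
      using w by (auto simp: orth_def)
    ultimately have "vec.span U \<subseteq> {v. B v w = 0}"
      by (rule vec.span_minimal[rotated])
    then show "w \<in> orth B (vec.span U)"
      by (auto simp: orth_def)
  qed
qed

lemma orth_UNIV:
  assumes B: "sym_bilinear_nondeg B"
  shows "orth B UNIV = {0}"
proof -
  have "w = 0" if "w \<in> orth B UNIV" for w
  proof -
    have "B w v = 0" for v
      using that B by (simp add: orth_def sym_bilinear_nondeg_def)
    then show ?thesis
      using B by (simp add: sym_bilinear_nondeg_def)
  qed
  then show ?thesis
    by (auto simp: orth_def sym_bilinear_nondeg_bilinear[OF B])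
qed

lemma dim_le_dim_Int_kernel:
  fixes f :: "'a::field ^ 'n \<Rightarrow> 'a"
  assumes W: "vec.subspace W" and f: "Vector_Spaces.linear (*s) (*) f"
  shows "vec.dim W \<le> vec.dim (W \<inter> {x. f x = 0}) + 1"
proof (cases "\<forall>w\<in>W. f w = 0")
  case True
  then have "W \<inter> {x. f x = 0} = W" by auto
  then show ?thesis by simp
next
  case False
  interpret f: Vector_Spaces.linear "(*s)" "(*)" f by (rule f)
  define K where "K = W \<inter> {x. f x = 0}"
  from False obtain w0 where w0: "w0 \<in> W" "f w0 \<noteq> 0" by auto
  have "W \<subseteq> vec.span (insert w0 K)"
  proof
    fix w assume w: "w \<in> W"
    define c where "c = f w / f w0"
    have "w - c *s w0 \<in> K"
      using w w0 W by (auto simp: K_def f.diff f.scale c_def vec.subspace_diff vec.subspace_scale)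
    then have "(w - c *s w0) + c *s w0 \<in> vec.span (insert w0 K)"
      by (intro vec.span_add) (simp_all add: vec.span_base vec.span_scale)
    then show "w \<in> vec.span (insert w0 K)" by simp
  qed
  then have "vec.dim W \<le> vec.dim (insert w0 K)"
    by (rule vec.dim_mono)
  also have "\<dots> \<le> vec.dim K + 1"
    by (simp add: vec.dim_insert)
  finally show ?thesis unfolding K_def .
qed

lemma dim_le_dim_Int_orth:
  assumes B: "sym_bilinear_nondeg B" and "finite S" and W: "vec.subspace W"
  shows "vec.dim W \<le> vec.dim (W \<inter> orth B S) + card S"
  using \<open>finite S\<close>
proof (induction S rule: finite_induct)
  case empty
  then show ?case by (simp add: orth_def)
next
  case (insert s S)
  have "vec.dim (W \<inter> orth B S) \<le> vec.dim ((W \<inter> orth B S) \<inter> {x. B s x = 0}) + 1"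
    using B W orth_subspace[OF B]
    by (intro dim_le_dim_Int_kernel[of _ "B s"] vec.subspace_inter) (auto simp: sym_bilinear_nondeg_def)
  moreover have "(W \<inter> orth B S) \<inter> {x. B s x = 0} = W \<inter> orth B (insert s S)"
    by (auto simp: orth_def)
  ultimately show ?case
    using insert by simp
qed

text \<open>The lower bound counts one hyperplane per basis vector of U; for the upper bound, a basis
  S of U is extended to a basis T of the whole space, and then the vectors of T - S cut the
  complement of U down to orth B T = 0.\<close>

lemma dim_orth_add_dim:
  fixes B :: "'a::field ^ 'n \<Rightarrow> 'a ^ 'n \<Rightarrow> 'a"
  assumes B: "sym_bilinear_nondeg B"
  shows "vec.dim (orth B U) + vec.dim U = vec.dim (UNIV :: ('a ^ 'n) set)"
proof -
  obtain S where S: "S \<subseteq> U" "vec.independent S" "U \<subseteq> vec.span S" "card S = vec.dim U"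
    using vec.basis_exists by blast
  obtain T where T: "S \<subseteq> T" "T \<subseteq> UNIV" "vec.independent T" "UNIV \<subseteq> vec.span T"
    by (rule vec.maximal_independent_subset_extend[OF subset_UNIV S(2)])
  have span_T: "vec.span T = UNIV"
    using T(4) by blast
  have fin: "finite S" "finite T"
    using S(2) T(3) by (simp_all add: vec.finiteI_independent)
  have orth_S: "orth B U = orth B S"
  proof
    show "orth B U \<subseteq> orth B S"
      using S(1) by (rule orth_antimono)
    show "orth B S \<subseteq> orth B U"
      using orth_antimono[OF S(3), of B] orth_span[OF B, of S] by simp
  qed
  have card_T: "card T = vec.dim (UNIV :: ('a ^ 'n) set)"
    using vec.dim_span_eq_card_independent[OF T(3)] span_T by simp
  have "vec.dim (UNIV :: ('a ^ 'n) set) \<le> vec.dim (orth B S) + card S"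
    using dim_le_dim_Int_orth[OF B fin(1) vec.subspace_UNIV] by simp
  moreover have "S \<union> (T - S) = T"
    using T(1) by blast
  then have "orth B S \<inter> orth B (T - S) = orth B (vec.span T)"
    using orth_span[OF B, of T] orth_Un[of B S "T - S"] by simp
  then have "orth B S \<inter> orth B (T - S) = {0}"
    using span_T orth_UNIV[OF B] by simp
  then have "vec.dim (orth B S) \<le> card (T - S)"
    using fin dim_le_dim_Int_orth[OF B _ orth_subspace[OF B], of "T - S" S] by simp
  moreover have "card (T - S) + card S = card T"
    using T(1) fin by (simp add: card_Diff_subset card_mono)
  ultimately show ?thesis
    unfolding orth_S using S(4) card_T by linarith
qed

lemma dim_span_Un_add_dim_Int:
  assumes "vec.subspace S" "vec.subspace T"
  shows "vec.dim (vec.span (S \<union> T)) + vec.dim (S \<inter> T) = vec.dim S + vec.dim T"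
proof -
  have "vec.span (S \<union> T) = {x + y |x y. x \<in> S \<and> y \<in> T}"
    using assms by (simp only: vec.span_Un vec.span_eq_iff[THEN iffD2])
  then show ?thesis
    using vec.dim_sums_Int[OF assms] by simp
qed

lemma dim_orth_Un_add_dim:
  fixes B :: "'a::field ^ 'n \<Rightarrow> 'a ^ 'n \<Rightarrow> 'a"
  assumes B: "sym_bilinear_nondeg B" and V: "vec.subspace V" and W: "vec.subspace W"
  shows "vec.dim (orth B (V \<union> W)) + vec.dim W = vec.dim (orth B V) + vec.dim (V \<inter> W)"
proof -
  have "vec.dim (orth B (V \<union> W)) + vec.dim (vec.span (V \<union> W)) = vec.dim (UNIV :: ('a ^ 'n) set)"
    using dim_orth_add_dim[OF B, of "V \<union> W"] by simp
  moreover have "vec.dim (vec.span (V \<union> W)) + vec.dim (V \<inter> W) = vec.dim V + vec.dim W"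
    using V W by (rule dim_span_Un_add_dim_Int)
  moreover have "vec.dim (orth B V) + vec.dim V = vec.dim (UNIV :: ('a ^ 'n) set)"
    using B by (rule dim_orth_add_dim)
  ultimately show ?thesis
    by linarith
qed

lemma dim_add_dim_le_dim_Int_orth:
  assumes B: "sym_bilinear_nondeg B" and V: "vec.subspace V"
    and Y: "Y \<subseteq> orth B V" "Y \<subseteq> W"
  shows "vec.dim Y + vec.dim V \<le> vec.dim W + vec.dim (V \<inter> orth B W)"
proof -
  have "W \<subseteq> orth B (orth B W)"
    by (simp add: subset_orth_commute[OF B, of W])
  then have "Y \<subseteq> orth B (V \<union> orth B W)"
    using Y by (auto simp: orth_Un)
  then have "vec.dim Y \<le> vec.dim (orth B (V \<union> orth B W))"
    by (rule vec.dim_subset)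
  moreover have "vec.dim (orth B (V \<union> orth B W)) + vec.dim (orth B W)
      = vec.dim (orth B V) + vec.dim (V \<inter> orth B W)"
    using B V orth_subspace[OF B] by (rule dim_orth_Un_add_dim)
  moreover have "vec.dim (orth B W) + vec.dim W = vec.dim (orth B V) + vec.dim V"
    using dim_orth_add_dim[OF B, of W] dim_orth_add_dim[OF B, of V] by simp
  ultimately show ?thesis
    by linarith
qed

lemma subspace_complement_exists:
  assumes U: "vec.subspace U" and "T \<subseteq> U"
  obtains R where "vec.subspace R" "vec.span (T \<union> R) = U" "vec.dim R + vec.dim T \<le> vec.dim U"
proof -
  obtain S where S: "S \<subseteq> T" "vec.independent S" "T \<subseteq> vec.span S" "card S = vec.dim T"
    using vec.basis_exists by blast
  obtain S' where S': "S \<subseteq> S'" "S' \<subseteq> U" "vec.independent S'" "U \<subseteq> vec.span S'"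
    using vec.maximal_independent_subset_extend[of S U] S(1,2) \<open>T \<subseteq> U\<close> by blast
  have fin: "finite S'"
    using S'(3) by (rule vec.finiteI_independent)
  have "vec.span S' = U"
    using S'(2,4) U by (simp add: vec.span_minimal subset_antisym)
  then have card_S': "card S' = vec.dim U"
    using vec.dim_span_eq_card_independent[OF S'(3)] by simp
  define R where "R = vec.span (S' - S)"
  show ?thesis
  proof
    show "vec.subspace R"
      by (simp add: R_def)
    have "R \<subseteq> U"
      unfolding R_def using S'(2) U by (intro vec.span_minimal) auto
    then have "vec.span (T \<union> R) \<subseteq> U"
      using \<open>T \<subseteq> U\<close> U by (simp add: vec.span_minimal)
    moreover have "S' \<subseteq> T \<union> R"
      using S(1) S'(1) by (auto simp: R_def intro: vec.span_base)
    then have "U \<subseteq> vec.span (T \<union> R)"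
      using S'(4) vec.span_mono by blast
    ultimately show "vec.span (T \<union> R) = U" by blast
    have "vec.dim R \<le> card (S' - S)"
      using fin by (auto simp: R_def intro: vec.dim_le_card vec.span_base)
    also have "\<dots> = card S' - card S"
      using S'(1) fin by (simp add: card_Diff_subset finite_subset)
    finally have "vec.dim R \<le> card S' - card S" .
    moreover have "card S \<le> card S'"
      using S'(1) fin by (simp add: card_mono)
    ultimately show "vec.dim R + vec.dim T \<le> vec.dim U"
      using S(4) card_S' by linarith
  qed
qed

section \<open>Rank functions\<close>

lemma qmatroid_mono:
  "qmatroid \<rho> \<Longrightarrow> vec.subspace V \<Longrightarrow> vec.subspace W \<Longrightarrow> V \<subseteq> W \<Longrightarrow> \<rho> V \<le> \<rho> W"
  unfolding qmatroid_def qsubspace_def by blast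

lemma qmatroid_increase_le_dim:
  assumes M: "qmatroid \<rho>" and T: "vec.subspace T" and U: "vec.subspace U" and "T \<subseteq> U"
  shows "\<rho> U \<le> \<rho> T + int (vec.dim U) - int (vec.dim T)"
proof -
  obtain R where R: "vec.subspace R" "vec.span (T \<union> R) = U" "vec.dim R + vec.dim T \<le> vec.dim U"
    using subspace_complement_exists[OF U \<open>T \<subseteq> U\<close>] by blast
  have "\<rho> U + \<rho> (T \<inter> R) \<le> \<rho> T + \<rho> R"
    using M T R(1) unfolding R(2)[symmetric] by (simp add: qmatroid_def qsubspace_def)
  moreover have "0 \<le> \<rho> (T \<inter> R)" "\<rho> R \<le> int (vec.dim R)"
    using M T R(1) vec.subspace_inter by (auto simp: qmatroid_def qsubspace_def qdim_def)
  moreover have "int (vec.dim R) \<le> int (vec.dim U) - int (vec.dim T)"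
    using R(3) by simp
  ultimately show ?thesis
    by linarith
qed

section \<open>Coordinates of the direct sum\<close>

definition in1 :: "'a::zero ^ 'n \<Rightarrow> 'a ^ ('n::finite + 'm::finite)" where
  "in1 c = (\<chi> i. case i of Inl j \<Rightarrow> c $ j | Inr _ \<Rightarrow> 0)"

definition in2 :: "'a::zero ^ 'm \<Rightarrow> 'a ^ ('n::finite + 'm::finite)" where
  "in2 d = (\<chi> i. case i of Inl _ \<Rightarrow> 0 | Inr j \<Rightarrow> d $ j)"

lemma proj_in [simp]:
  "proj1 (in1 c) = c" "proj2 (in1 c :: 'a::zero ^ ('n::finite + 'm::finite)) = 0"
  "proj1 (in2 d :: 'a::zero ^ ('n::finite + 'm::finite)) = 0" "proj2 (in2 d) = d"
  by (auto simp: proj1_def proj2_def in1_def in2_def vec_eq_iff)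

lemma in_zero [simp]: "in1 0 = 0" "in2 0 = 0"
  by (auto simp: in1_def in2_def vec_eq_iff split: sum.splits)

lemma in1_proj1_add_in2_proj2:
  "in1 (proj1 x) + in2 (proj2 x) = (x :: 'a::monoid_add ^ ('n::finite + 'm::finite))"
  by (auto simp: proj1_def proj2_def in1_def in2_def vec_eq_iff split: sum.splits)

lemma proj_linear [simp]:
  "proj1 (x + y) = proj1 x + proj1 y" "proj1 (c *s x) = c *s proj1 x" "proj1 0 = 0"
  "proj2 (x + y) = proj2 x + proj2 y" "proj2 (c *s x) = c *s proj2 x" "proj2 0 = 0"
  by (auto simp: proj1_def proj2_def vec_eq_iff)

lemma linear_in1: "Vector_Spaces.linear (*s) (*s) (in1 :: 'a::field ^ 'n \<Rightarrow> 'a ^ ('n::finite + 'm::finite))"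
  by unfold_locales (auto simp: in1_def vec_eq_iff split: sum.splits)

lemma linear_in2: "Vector_Spaces.linear (*s) (*s) (in2 :: 'a::field ^ 'm \<Rightarrow> 'a ^ ('n::finite + 'm::finite))"
  by unfold_locales (auto simp: in2_def vec_eq_iff split: sum.splits)

lemma linear_proj1: "Vector_Spaces.linear (*s) (*s) (proj1 :: 'a::field ^ ('n::finite + 'm::finite) \<Rightarrow> 'a ^ 'n)"
  by unfold_locales simp_all

lemma linear_proj2: "Vector_Spaces.linear (*s) (*s) (proj2 :: 'a::field ^ ('n::finite + 'm::finite) \<Rightarrow> 'a ^ 'm)"
  by unfold_locales simp_all

lemma subspace_proj_image:
  assumes "vec.subspace X"
  shows "vec.subspace (proj1 ` X)" "vec.subspace (proj2 ` X)"
  using assms by (simp_all add: vec.linear_subspace_image[OF linear_proj1]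
      vec.linear_subspace_image[OF linear_proj2])

lemma sum_form_in1: "sym_bilinear_nondeg B2 \<Longrightarrow> sum_form B1 B2 (in1 c) x = B1 c (proj1 x)"
  by (simp add: sum_form_def sym_bilinear_nondeg_bilinear)

lemma sum_form_in2: "sym_bilinear_nondeg B1 \<Longrightarrow> sum_form B1 B2 (in2 d) x = B2 d (proj2 x)"
  by (simp add: sum_form_def sym_bilinear_nondeg_bilinear)

lemma sym_bilinear_nondeg_sum_form:
  assumes B1: "sym_bilinear_nondeg B1" and B2: "sym_bilinear_nondeg B2"
  shows "sym_bilinear_nondeg (sum_form B1 B2)"
  unfolding sym_bilinear_nondeg_def
proof (intro conjI allI impI)
  fix x
  show "Vector_Spaces.linear (*s) (*) (sum_form B1 B2 x)"
    by unfold_locales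
      (auto simp: sum_form_def sym_bilinear_nondeg_bilinear[OF B1] sym_bilinear_nondeg_bilinear[OF B2]
        algebra_simps)
next
  fix x y
  show "sum_form B1 B2 x y = sum_form B1 B2 y x"
    using B1 B2 by (simp add: sum_form_def sym_bilinear_nondeg_def)
next
  fix x assume x: "\<forall>y. sum_form B1 B2 x y = 0"
  have "B1 (proj1 x) c = 0" for c
    using x[rule_format, of "in1 c"] by (simp add: sum_form_def sym_bilinear_nondeg_bilinear[OF B2])
  then have "proj1 x = 0"
    using B1 by (simp add: sym_bilinear_nondeg_def)
  have "B2 (proj2 x) d = 0" for d
    using x[rule_format, of "in2 d"] by (simp add: sum_form_def sym_bilinear_nondeg_bilinear[OF B1])
  then have "proj2 x = 0"
    using B2 by (simp add: sym_bilinear_nondeg_def)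
  moreover note \<open>proj1 x = 0\<close>
  ultimately show "x = 0"
    using in1_proj1_add_in2_proj2[of x] by simp
qed

definition dsum :: "('a::zero ^ 'n) set \<Rightarrow> ('a ^ 'm) set \<Rightarrow> ('a ^ ('n::finite + 'm::finite)) set" where
  "dsum A B = {x. proj1 x \<in> A \<and> proj2 x \<in> B}"

lemma subset_dsum_proj: "X \<subseteq> dsum (proj1 ` X) (proj2 ` X)"
  by (auto simp: dsum_def)

lemma subspace_dsum:
  "vec.subspace A \<Longrightarrow> vec.subspace B \<Longrightarrow> vec.subspace (dsum A B)"
  by (auto simp: vec.subspace_def dsum_def)

lemma dim_dsum_le:
  fixes A :: "('a::field ^ 'n::finite) set" and B :: "('a ^ 'm::finite) set"
  assumes A: "vec.subspace A" and B: "vec.subspace B"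
  shows "vec.dim (dsum A B) \<le> vec.dim A + vec.dim B"
proof -
  let ?A = "in1 ` A :: ('a ^ ('n + 'm)) set" and ?B = "in2 ` B :: ('a ^ ('n + 'm)) set"
  have sub: "vec.subspace ?A" "vec.subspace ?B"
    using A B by (simp_all add: vec.linear_subspace_image[OF linear_in1]
        vec.linear_subspace_image[OF linear_in2])
  have "vec.dim (dsum A B) \<le> vec.dim {x + y |x y. x \<in> ?A \<and> y \<in> ?B}"
  proof (rule vec.dim_subset, rule subsetI)
    fix x assume "x \<in> dsum A B"
    then have "in1 (proj1 x) \<in> ?A" "in2 (proj2 x) \<in> ?B"
      by (auto simp: dsum_def)
    then show "x \<in> {x + y |x y. x \<in> ?A \<and> y \<in> ?B}"
      using in1_proj1_add_in2_proj2[of x, symmetric] by blast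
  qed
  also have "\<dots> \<le> vec.dim ?A + vec.dim ?B"
    using vec.dim_sums_Int[OF sub] by linarith
  also have "\<dots> \<le> vec.dim A + vec.dim B"
    by (intro add_mono vec.dim_image_le linear_in1 linear_in2)
  finally show ?thesis .
qed

lemma proj_orth_dsum:
  assumes B1: "sym_bilinear_nondeg B1" and B2: "sym_bilinear_nondeg B2"
    and "0 \<in> A" "0 \<in> B" and x: "x \<in> orth (sum_form B1 B2) (dsum A B)"
  shows "proj1 x \<in> orth B1 A" "proj2 x \<in> orth B2 B"
proof -
  have "B1 a (proj1 x) = 0" if "a \<in> A" for a
  proof -
    have "in1 a \<in> dsum A B"
      using that \<open>0 \<in> B\<close> by (simp add: dsum_def)
    then show ?thesis
      using x sum_form_in1[OF B2, of B1 a x] by (simp add: orth_def)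
  qed
  then show "proj1 x \<in> orth B1 A"
    by (simp add: orth_def)
  have "B2 b (proj2 x) = 0" if "b \<in> B" for b
  proof -
    have "in2 b \<in> dsum A B"
      using that \<open>0 \<in> A\<close> by (simp add: dsum_def)
    then show ?thesis
      using x sum_form_in2[OF B1, of B2 b x] by (simp add: orth_def)
  qed
  then show "proj2 x \<in> orth B2 B"
    by (simp add: orth_def)
qed

lemma dim_UNIV_sum:
  "vec.dim (UNIV :: ('a::field ^ ('n::finite + 'm::finite)) set)
     = vec.dim (UNIV :: ('a ^ 'n) set) + vec.dim (UNIV :: ('a ^ 'm) set)"
  by (simp add: card_cart_basis flip: card_Plus UNIV_Plus_UNIV)

section \<open>Duality of the direct-sum rank\<close>

definition dsum_excess :: "(('a::{field,finite} ^ 'n) set \<Rightarrow> int) \<Rightarrow> (('a ^ 'm) set \<Rightarrow> int)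
    \<Rightarrow> ('a ^ ('n::finite + 'm::finite)) set \<Rightarrow> int" where
  "dsum_excess \<rho>1 \<rho>2 X = \<rho>1 (proj1 ` X) + \<rho>2 (proj2 ` X) - qdim X"

lemma qdirect_sum_eq_Min_dsum_excess:
  "qdirect_sum \<rho>1 \<rho>2 V = qdim V + Min {dsum_excess \<rho>1 \<rho>2 X | X. qsubspace X \<and> X \<subseteq> V}"
  by (simp add: qdirect_sum_def dsum_excess_def)

lemma Min_add_le_Min_add:
  fixes g :: "'x::finite \<Rightarrow> 'b::linordered_ab_group_add" and h :: "'y::finite \<Rightarrow> 'b"
  assumes "P x0" and dominated: "\<And>X. P X \<Longrightarrow> \<exists>Y. Q Y \<and> h Y + d \<le> g X + c"
  shows "Min {h Y | Y. Q Y} + d \<le> Min {g X | X. P X} + c"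
proof -
  have "Min {g X | X. P X} \<in> {g X | X. P X}"
    using \<open>P x0\<close> by (intro Min_in) auto
  then obtain X where X: "P X" "Min {g X | X. P X} = g X"
    by blast
  then obtain Y where Y: "Q Y" "h Y + d \<le> g X + c"
    using dominated by blast
  then have "Min {h Y | Y. Q Y} \<le> h Y"
    by (intro Min_le) auto
  then have "Min {h Y | Y. Q Y} + d \<le> h Y + d"
    by (rule add_right_mono)
  also have "\<dots> \<le> Min {g X | X. P X} + c"
    using X(2) Y(2) by simp
  finally show ?thesis .
qed

lemma qdirect_sum_UNIV:
  fixes \<rho>1 :: "('a::{field,finite} ^ 'n) set \<Rightarrow> int" and \<rho>2 :: "('a ^ 'm) set \<Rightarrow> int"
  assumes M1: "qmatroid \<rho>1" and M2: "qmatroid \<rho>2"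
  shows "qdirect_sum \<rho>1 \<rho>2 UNIV = \<rho>1 UNIV + \<rho>2 UNIV"
proof -
  let ?N = "vec.dim (UNIV :: ('a ^ ('n + 'm)) set)"
  have lower: "\<rho>1 UNIV + \<rho>2 UNIV - int ?N \<le> dsum_excess \<rho>1 \<rho>2 X" if X: "vec.subspace X" for X
  proof -
    have sub: "vec.subspace (proj1 ` X)" "vec.subspace (proj2 ` X)"
      using subspace_proj_image[OF X] by blast+
    have "\<rho>1 UNIV \<le> \<rho>1 (proj1 ` X) + int (vec.dim (UNIV :: ('a ^ 'n) set)) - int (vec.dim (proj1 ` X))"
      using qmatroid_increase_le_dim[OF M1 sub(1) vec.subspace_UNIV subset_UNIV] by simp
    moreover have "\<rho>2 UNIV \<le> \<rho>2 (proj2 ` X) + int (vec.dim (UNIV :: ('a ^ 'm) set)) - int (vec.dim (proj2 ` X))"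
      using qmatroid_increase_le_dim[OF M2 sub(2) vec.subspace_UNIV subset_UNIV] by simp
    moreover have "vec.dim X \<le> vec.dim (proj1 ` X) + vec.dim (proj2 ` X)"
      using vec.dim_subset[OF subset_dsum_proj] dim_dsum_le[OF sub] by (rule order_trans)
    ultimately show ?thesis
      using dim_UNIV_sum[where 'a='a and 'n='n and 'm='m] by (simp add: dsum_excess_def qdim_def)
  qed
  have "surj (proj1 :: 'a ^ ('n + 'm) \<Rightarrow> 'a ^ 'n)" "surj (proj2 :: 'a ^ ('n + 'm) \<Rightarrow> 'a ^ 'm)"
    by (metis proj_in(1) surjI) (metis proj_in(4) surjI)
  then have "dsum_excess \<rho>1 \<rho>2 UNIV = \<rho>1 UNIV + \<rho>2 UNIV - int ?N"
    by (simp add: dsum_excess_def qdim_def)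
  moreover have "dsum_excess \<rho>1 \<rho>2 UNIV \<in> {dsum_excess \<rho>1 \<rho>2 X | X. qsubspace X \<and> X \<subseteq> UNIV}"
    unfolding qsubspace_def by (rule CollectI, rule exI[of _ UNIV]) simp
  ultimately have "Min {dsum_excess \<rho>1 \<rho>2 X | X. qsubspace X \<and> X \<subseteq> UNIV} = \<rho>1 UNIV + \<rho>2 UNIV - int ?N"
    using lower by (intro Min_eqI) (auto simp: qsubspace_def)
  then show ?thesis
    by (simp add: qdirect_sum_eq_Min_dsum_excess qdim_def)
qed

lemma dsum_excess_orth_le_dual:
  fixes \<rho>1 :: "('a::{field,finite} ^ 'n) set \<Rightarrow> int" and \<rho>2 :: "('a ^ 'm) set \<Rightarrow> int"
    and V X :: "('a ^ ('n + 'm)) set"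
  assumes M1: "qmatroid \<rho>1" and M2: "qmatroid \<rho>2"
    and B1: "sym_bilinear_nondeg B1" and B2: "sym_bilinear_nondeg B2"
    and V: "vec.subspace V" and X: "vec.subspace X" "X \<subseteq> V"
  obtains Y where "vec.subspace Y" "Y \<subseteq> orth (sum_form B1 B2) V"
    "dsum_excess \<rho>1 \<rho>2 Y + qdim (orth (sum_form B1 B2) V)
       \<le> dsum_excess (qdual B1 \<rho>1) (qdual B2 \<rho>2) X + (\<rho>1 UNIV + \<rho>2 UNIV)"
proof -
  let ?B = "sum_form B1 B2"
  have B: "sym_bilinear_nondeg ?B"
    using B1 B2 by (rule sym_bilinear_nondeg_sum_form)
  define X1 X2 where "X1 = proj1 ` X" and "X2 = proj2 ` X"
  define W where "W = dsum X1 X2"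
  define Y where "Y = orth ?B (V \<union> W)"
  have sub: "vec.subspace X1" "vec.subspace X2"
    unfolding X1_def X2_def using subspace_proj_image[OF X(1)] by blast+
  then have W: "vec.subspace W"
    unfolding W_def by (rule subspace_dsum)
  show ?thesis
  proof
    show "vec.subspace Y"
      unfolding Y_def using B by (rule orth_subspace)
    show "Y \<subseteq> orth ?B V"
      unfolding Y_def by (rule orth_antimono) blast
    have "Y \<subseteq> orth ?B W"
      unfolding Y_def by (rule orth_antimono) blast
    then have "proj1 ` Y \<subseteq> orth B1 X1" "proj2 ` Y \<subseteq> orth B2 X2"
      using proj_orth_dsum[OF B1 B2 vec.subspace_0[OF sub(1)] vec.subspace_0[OF sub(2)]]
      unfolding W_def by blast+
    then have "\<rho>1 (proj1 ` Y) \<le> \<rho>1 (orth B1 X1)" "\<rho>2 (proj2 ` Y) \<le> \<rho>2 (orth B2 X2)"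
      using subspace_proj_image[OF \<open>vec.subspace Y\<close>]
      by (simp_all add: qmatroid_mono[OF M1] qmatroid_mono[OF M2] orth_subspace B1 B2)
    moreover have "vec.dim Y + vec.dim W = vec.dim (orth ?B V) + vec.dim (V \<inter> W)"
      unfolding Y_def using B V W by (rule dim_orth_Un_add_dim)
    moreover have "vec.dim W \<le> vec.dim X1 + vec.dim X2"
      unfolding W_def using sub by (rule dim_dsum_le)
    moreover have "vec.dim X \<le> vec.dim (V \<inter> W)"
      using X(2) subset_dsum_proj[of X] unfolding W_def X1_def X2_def by (intro vec.dim_subset) blast
    ultimately show "dsum_excess \<rho>1 \<rho>2 Y + qdim (orth ?B V)
        \<le> dsum_excess (qdual B1 \<rho>1) (qdual B2 \<rho>2) X + (\<rho>1 UNIV + \<rho>2 UNIV)"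
      unfolding dsum_excess_def qdual_def qdim_def X1_def[symmetric] X2_def[symmetric] by linarith
  qed
qed

lemma dsum_excess_dual_le_orth:
  fixes \<rho>1 :: "('a::{field,finite} ^ 'n) set \<Rightarrow> int" and \<rho>2 :: "('a ^ 'm) set \<Rightarrow> int"
    and V Y :: "('a ^ ('n + 'm)) set"
  assumes M1: "qmatroid \<rho>1" and M2: "qmatroid \<rho>2"
    and B1: "sym_bilinear_nondeg B1" and B2: "sym_bilinear_nondeg B2"
    and V: "vec.subspace V" and Y: "vec.subspace Y" "Y \<subseteq> orth (sum_form B1 B2) V"
  obtains X where "vec.subspace X" "X \<subseteq> V"
    "dsum_excess (qdual B1 \<rho>1) (qdual B2 \<rho>2) X + (\<rho>1 UNIV + \<rho>2 UNIV)
       \<le> dsum_excess \<rho>1 \<rho>2 Y + qdim (orth (sum_form B1 B2) V)"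
proof -
  let ?B = "sum_form B1 B2" and ?N = "vec.dim (UNIV :: ('a ^ ('n + 'm)) set)"
  have B: "sym_bilinear_nondeg ?B"
    using B1 B2 by (rule sym_bilinear_nondeg_sum_form)
  define Y1 Y2 where "Y1 = proj1 ` Y" and "Y2 = proj2 ` Y"
  define W where "W = dsum Y1 Y2"
  define X where "X = V \<inter> orth ?B W"
  define X1 X2 where "X1 = proj1 ` X" and "X2 = proj2 ` X"
  have sub: "vec.subspace Y1" "vec.subspace Y2"
    unfolding Y1_def Y2_def using subspace_proj_image[OF Y(1)] by blast+
  show ?thesis
  proof
    show "vec.subspace X"
      unfolding X_def using V orth_subspace[OF B] by (rule vec.subspace_inter)
    show "X \<subseteq> V"
      unfolding X_def by blast
    have "X \<subseteq> orth ?B W"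
      unfolding X_def by blast
    then have "X1 \<subseteq> orth B1 Y1" "X2 \<subseteq> orth B2 Y2"
      using proj_orth_dsum[OF B1 B2 vec.subspace_0[OF sub(1)] vec.subspace_0[OF sub(2)]]
      unfolding X1_def X2_def W_def by blast+
    then have "Y1 \<subseteq> orth B1 X1" "Y2 \<subseteq> orth B2 X2"
      by (simp_all add: subset_orth_commute[OF B1, of Y1] subset_orth_commute[OF B2, of Y2])
    then have "\<rho>1 (orth B1 X1) \<le> \<rho>1 Y1 + int (vec.dim (orth B1 X1)) - int (vec.dim Y1)"
        "\<rho>2 (orth B2 X2) \<le> \<rho>2 Y2 + int (vec.dim (orth B2 X2)) - int (vec.dim Y2)"
      using qmatroid_increase_le_dim[OF M1 sub(1) orth_subspace[OF B1]]
        qmatroid_increase_le_dim[OF M2 sub(2) orth_subspace[OF B2]] by simp_all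
    moreover have "vec.dim (orth B1 X1) + vec.dim X1 = vec.dim (UNIV :: ('a ^ 'n) set)"
      "vec.dim (orth B2 X2) + vec.dim X2 = vec.dim (UNIV :: ('a ^ 'm) set)"
      using B1 B2 by (simp_all add: dim_orth_add_dim)
    moreover have "vec.dim W \<le> vec.dim Y1 + vec.dim Y2"
      unfolding W_def using sub by (rule dim_dsum_le)
    moreover have "vec.dim Y + vec.dim V \<le> vec.dim W + vec.dim X"
      unfolding X_def W_def Y1_def Y2_def using B V Y(2) subset_dsum_proj
      by (rule dim_add_dim_le_dim_Int_orth)
    moreover have "vec.dim (orth ?B V) + vec.dim V = ?N"
      using B by (rule dim_orth_add_dim)
    ultimately show "dsum_excess (qdual B1 \<rho>1) (qdual B2 \<rho>2) X + (\<rho>1 UNIV + \<rho>2 UNIV)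
        \<le> dsum_excess \<rho>1 \<rho>2 Y + qdim (orth ?B V)"
      using dim_UNIV_sum[where 'a='a and 'n='n and 'm='m]
      unfolding dsum_excess_def qdual_def qdim_def X1_def[symmetric] X2_def[symmetric]
        Y1_def[symmetric] Y2_def[symmetric]
      by linarith
  qed
qed

lemma qdirect_sum_orth:
  fixes \<rho>1 :: "('a::{field,finite} ^ 'n) set \<Rightarrow> int" and \<rho>2 :: "('a ^ 'm) set \<Rightarrow> int"
    and V :: "('a ^ ('n + 'm)) set"
  assumes M1: "qmatroid \<rho>1" and M2: "qmatroid \<rho>2"
    and B1: "sym_bilinear_nondeg B1" and B2: "sym_bilinear_nondeg B2"
    and V: "vec.subspace V"
  shows "qdirect_sum \<rho>1 \<rho>2 (orth (sum_form B1 B2) V)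
    = Min {dsum_excess (qdual B1 \<rho>1) (qdual B2 \<rho>2) X | X. qsubspace X \<and> X \<subseteq> V} + (\<rho>1 UNIV + \<rho>2 UNIV)"
proof -
  let ?V' = "orth (sum_form B1 B2) V"
  have "Min {dsum_excess \<rho>1 \<rho>2 Y | Y. qsubspace Y \<and> Y \<subseteq> ?V'} + qdim ?V'
      \<le> Min {dsum_excess (qdual B1 \<rho>1) (qdual B2 \<rho>2) X | X. qsubspace X \<and> X \<subseteq> V} + (\<rho>1 UNIV + \<rho>2 UNIV)"
  proof (rule Min_add_le_Min_add)
    show "qsubspace {0} \<and> {0} \<subseteq> V"
      using V by (simp add: qsubspace_def vec.subspace_0)
    show "\<exists>Y. (qsubspace Y \<and> Y \<subseteq> ?V') \<and> dsum_excess \<rho>1 \<rho>2 Y + qdim ?V'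
        \<le> dsum_excess (qdual B1 \<rho>1) (qdual B2 \<rho>2) X + (\<rho>1 UNIV + \<rho>2 UNIV)"
      if "qsubspace X \<and> X \<subseteq> V" for X
    proof -
      have X: "vec.subspace X" "X \<subseteq> V"
        using that by (simp_all add: qsubspace_def)
      obtain Y where "vec.subspace Y" "Y \<subseteq> ?V'" "dsum_excess \<rho>1 \<rho>2 Y + qdim ?V'
          \<le> dsum_excess (qdual B1 \<rho>1) (qdual B2 \<rho>2) X + (\<rho>1 UNIV + \<rho>2 UNIV)"
        by (rule dsum_excess_orth_le_dual[OF M1 M2 B1 B2 V X])
      then show ?thesis
        unfolding qsubspace_def by blast
    qed
  qed
  moreover have "Min {dsum_excess (qdual B1 \<rho>1) (qdual B2 \<rho>2) X | X. qsubspace X \<and> X \<subseteq> V} + (\<rho>1 UNIV + \<rho>2 UNIV)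
      \<le> Min {dsum_excess \<rho>1 \<rho>2 Y | Y. qsubspace Y \<and> Y \<subseteq> ?V'} + qdim ?V'"
  proof (rule Min_add_le_Min_add)
    show "qsubspace {0} \<and> {0} \<subseteq> ?V'"
      using orth_subspace[OF sym_bilinear_nondeg_sum_form[OF B1 B2]]
      by (simp add: qsubspace_def vec.subspace_0)
    show "\<exists>X. (qsubspace X \<and> X \<subseteq> V) \<and> dsum_excess (qdual B1 \<rho>1) (qdual B2 \<rho>2) X + (\<rho>1 UNIV + \<rho>2 UNIV)
        \<le> dsum_excess \<rho>1 \<rho>2 Y + qdim ?V'"
      if "qsubspace Y \<and> Y \<subseteq> ?V'" for Y
    proof -
      have Y: "vec.subspace Y" "Y \<subseteq> ?V'"
        using that by (simp_all add: qsubspace_def)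
      obtain X where "vec.subspace X" "X \<subseteq> V" "dsum_excess (qdual B1 \<rho>1) (qdual B2 \<rho>2) X
          + (\<rho>1 UNIV + \<rho>2 UNIV) \<le> dsum_excess \<rho>1 \<rho>2 Y + qdim ?V'"
        by (rule dsum_excess_dual_le_orth[OF M1 M2 B1 B2 V Y])
      then show ?thesis
        unfolding qsubspace_def by blast
    qed
  qed
  ultimately show ?thesis
    unfolding qdirect_sum_eq_Min_dsum_excess by linarith
qed

theorem theorem5p10:
  fixes \<rho>1 :: "('a::{field,finite} ^ 'n) set \<Rightarrow> int"
    and \<rho>2 :: "('a ^ 'm) set \<Rightarrow> int"
    and B1 :: "'a ^ 'n \<Rightarrow> 'a ^ 'n \<Rightarrow> 'a"
    and B2 :: "'a ^ 'm \<Rightarrow> 'a ^ 'm \<Rightarrow> 'a"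
  assumes "qmatroid \<rho>1" and "qmatroid \<rho>2"
    and "sym_bilinear_nondeg B1" and "sym_bilinear_nondeg B2"
  shows "sym_bilinear_nondeg (sum_form B1 B2) \<and>
    (\<forall>V. qsubspace V \<longrightarrow>
       qdual (sum_form B1 B2) (qdirect_sum \<rho>1 \<rho>2) V
       = qdirect_sum (qdual B1 \<rho>1) (qdual B2 \<rho>2) V)"
proof (intro conjI allI impI)
  show "sym_bilinear_nondeg (sum_form B1 B2)"
    using assms(3,4) by (rule sym_bilinear_nondeg_sum_form)
  fix V :: "('a ^ ('n + 'm)) set"
  assume "qsubspace V"
  then have V: "vec.subspace V"
    by (simp add: qsubspace_def)
  have "qdual (sum_form B1 B2) (qdirect_sum \<rho>1 \<rho>2) V
      = qdim V + qdirect_sum \<rho>1 \<rho>2 (orth (sum_form B1 B2) V) - qdirect_sum \<rho>1 \<rho>2 UNIV"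
    by (simp only: qdual_def)
  also have "\<dots> = qdim V + Min {dsum_excess (qdual B1 \<rho>1) (qdual B2 \<rho>2) X | X. qsubspace X \<and> X \<subseteq> V}"
    using qdirect_sum_orth[OF assms V] qdirect_sum_UNIV[OF assms(1,2)] by simp
  also have "\<dots> = qdirect_sum (qdual B1 \<rho>1) (qdual B2 \<rho>2) V"
    by (rule qdirect_sum_eq_Min_dsum_excess[symmetric])
  finally show "qdual (sum_form B1 B2) (qdirect_sum \<rho>1 \<rho>2) V = qdirect_sum (qdual B1 \<rho>1) (qdual B2 \<rho>2) V" .
qed

end
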